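(* Let $(X_1,\dots,X_n)$ be the output of $\textsc{DepRound}$ run with probabilities $(p_1,\dots,p_n)\in(0,1)^n$ and unit weights $a_1=\dots=a_n=1$. Let $\alpha:=\min_i\min\{p_i,1-p_i\}$. Let $I^+,I^-$ be disjoint subsets of $[n]$ with $t:=|I^+\cup I^-|\ge 1$ and $\lambda:=\prod_{i\in I^+}p_i\prod_{i\in I^-}(1-p_i)$. Let $d$ be an integer satisfying $(1-\alpha)^d\le\alpha$ and $d\le(n-t)/t$. Then $$\left(1-\frac{td}{n-t}\right)^t\left(1-\frac{(1-\alpha)^d}{\alpha}\right)^{t-1}\lambda\le\mathbf{E}\left[\prod_{i\in I^+}X_i\prod_{i\in I^-}(1-X_i)\right].$$
   Context: With unit weights, $\textsc{Simplify}(1,1,\beta_1,\beta_2)$ for $\beta_1,\beta_2\in(0,1)$ outputs $(\gamma_1,\gamma_2)$ as follows: let $s=\beta_1+\beta_2$. If $s\le 1$: w.p. $\beta_2/s$ set $(\gamma_1,\gamma_2)=(0,\beta_1+\beta_2)$, otherwise $(\gamma_1,\gamma_2)=(\beta_1+\beta_2,0)$. If $s>1$: w.p. $(1-\beta_2)/((1-\beta_1)+(1-\beta_2))$ set $(\gamma_1,\gamma_2)=(1,\beta_1+\beta_2-1)$, otherwise $(\gamma_1,\gamma_2)=(\beta_1+\beta_2-1,1)$. $\textsc{DepRound}$ with $P=(p_1,\dots,p_n)$ and unit weights: set $X=P$; choose a uniformly random permutation $\pi$ of $[n]$; while $X$ has at least two entries in $(0,1)$, let $X_i,X_j$ be the two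 fractional entries earliest in the $\pi$-order ($X_i$ first) and replace $(X_i,X_j)$ by $\textsc{Simplify}(1,1,X_i,X_j)$; output $X$. *)

theory Defs
  imports "HOL-Probability.Probability" "HOL-Combinatorics.Multiset_Permutations"
begin

text \<open>
  \<open>simplify b1 b2\<close> is SIMPLIFY with both weights equal to 1; it is meant for arguments in (0,1).
\<close>

definition simplify :: "real \<Rightarrow> real \<Rightarrow> (real \<times> real) pmf" where
  "simplify b1 b2 =
     (if b1 + b2 \<le> 1 then
        map_pmf (\<lambda>c. if c then (0, b1 + b2) else (b1 + b2, 0))
          (bernoulli_pmf (b2 / (b1 + b2)))
      else
        map_pmf (\<lambda>c. if c then (1, b1 + b2 - 1) else (b1 + b2 - 1, 1))
          (bernoulli_pmf ((1 - b2) / ((1 - b1) + (1 - b2)))))"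

definition fractional :: "real \<Rightarrow> bool" where
  "fractional x \<longleftrightarrow> 0 < x \<and> x < 1"

lemma simplify_not_both_fractional:
  "(c1, c2) \<in> set_pmf (simplify b1 b2) \<Longrightarrow> \<not> (fractional c1 \<and> fractional c2)"
  by (auto simp: simplify_def fractional_def split: if_splits)

text \<open>
  The while loop of DEPROUND. The list \<open>\<pi>\<close> gives the indices in their processing order, so the
  first two elements of the filtered list are the two earliest fractional entries. The order
  is always a permutation, on which \<^const>\<open>remdups\<close> is the identity; its purpose is to make the
  recursion terminate for every argument.
\<close>

function dep_round_loop :: "nat list \<Rightarrow> (nat \<Rightarrow> real) \<Rightarrow> (nat \<Rightarrow> real) pmf" where
  "dep_round_loop \<pi> X =
     (case filter (\<lambda>i. fractional (X i)) (remdups \<pi>) of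
        i # j # _ \<Rightarrow>
          bind_pmf (simplify (X i) (X j)) (\<lambda>c. dep_round_loop \<pi> (X(i := fst c, j := snd c)))
      | _ \<Rightarrow> return_pmf X)"
  by pat_completeness auto
termination
proof (relation "Wellfounded.measure (\<lambda>(\<pi>, X). card {i \<in> set \<pi>. fractional (X i)})", goal_cases)
  case 1
  show ?case by simp
next
  case (2 \<pi> X i js j rest c)
  let ?Y = "X(i := fst c, j := snd c)"
  have eq: "filter (\<lambda>i. fractional (X i)) (remdups \<pi>) = i # j # rest"
    using 2 by simp
  then have "set (i # j # rest) = {k \<in> set \<pi>. fractional (X k)}"
    by (metis set_filter set_remdups)
  moreover have "distinct (i # j # rest)"
    using eq by (metis distinct_filter distinct_remdups)
  ultimately have ij: "i \<in> {k \<in> set \<pi>. fractional (X k)}" "j \<in> {k \<in> set \<pi>. fractional (X k)}" "i \<noteq> j"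
    by auto
  have "\<not> (fractional (fst c) \<and> fractional (snd c))"
    using 2 simplify_not_both_fractional by (metis prod.collapse)
  then have "{k \<in> set \<pi>. fractional (?Y k)} \<subset> {k \<in> set \<pi>. fractional (X k)}"
    using ij by (auto split: if_splits)
  then show ?case
    by (simp add: psubset_card_mono)
qed

declare dep_round_loop.simps [simp del]

text \<open>
  The index set is \<open>{1..n}\<close>; the values of \<open>p\<close> at other arguments play no role and are left unchanged.
\<close>

definition dep_round :: "nat \<Rightarrow> (nat \<Rightarrow> real) \<Rightarrow> (nat \<Rightarrow> real) pmf" where
  "dep_round n p = bind_pmf (pmf_of_set (permutations_of_set {1..n})) (\<lambda>\<pi>. dep_round_loop \<pi> p)"

end

theory Submission
  imports Defs
begin

text \<open>
  At every moment at most one index is processed but still undecided, the survivor. Which index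
  that is has no influence on the later rounding of the others, and a given survivor stays undecided
  through a step with probability at most \<open>1 - \<alpha>\<close>. So if in the order \<open>\<pi>\<close> at least \<open>d\<close> other
  indices lie between any two consecutive elements of \<open>Ip \<union> Im\<close>, each of these except the last
  loses at most a factor \<open>1 - (1 - \<alpha>) ^ d / \<alpha>\<close> against independent rounding. The number of such orders
  is \<open>t! (n - t)!\<close> times the binomial coefficient \<open>n - (t - 1) d\<close> over \<open>t\<close>, and the remaining orders
  contribute a nonnegative amount.
\<close>

section \<open>A single step of the rounding loop\<close>

text \<open>Both branches have one shape: with probability \<open>q\<close> the first argument is
  decided at \<open>v\<close> and the second carries \<open>c\<close>, otherwise the roles are
  swapped; both means are kept. The bound on \<open>q\<close> involves only \<open>b2\<close>,
  because the first argument will be the survivor, whose value may be arbitrarily close to 0 or 1,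
  while the second still has its original probability.\<close>

lemma simplify_fractional:
  assumes "fractional b1" "fractional b2"
  obtains q v c where
    "simplify b1 b2 = map_pmf (\<lambda>h. if h then (v, c) else (c, v)) (bernoulli_pmf q)"
    "min b2 (1 - b2) \<le> q" "0 \<le> q" "q \<le> 1" "v = 0 \<or> v = 1" "0 \<le> c" "c \<le> 1"
    "q * v + (1 - q) * c = b1" "(1 - q) * v + q * c = b2"
proof (cases "b1 + b2 \<le> 1")
  case True
  let ?q = "b2 / (b1 + b2)"
  have b: "0 < b1" "0 < b2" "b1 < 1" "b2 < 1"
    using assms by (auto simp: fractional_def)
  have "b2 * (b1 + b2) \<le> b2 * 1"
    using b True by (intro mult_left_mono) auto
  then have "b2 \<le> ?q"
    using b by (simp add: pos_le_divide_eq)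
  then have "min b2 (1 - b2) \<le> ?q"
    by linarith
  moreover have "?q * (b1 + b2) = b2"
    using b by simp
  then have "?q * (b1 + b2) = b2" "(1 - ?q) * (b1 + b2) = b1"
    by (simp_all add: left_diff_distrib)
  ultimately show thesis
    using b True
    by (intro that[where q = ?q and v = 0 and c = "b1 + b2"]) (auto simp: simplify_def)
next
  case False
  let ?q = "(1 - b2) / ((1 - b1) + (1 - b2))"
  have b: "0 < b1" "0 < b2" "b1 < 1" "b2 < 1"
    using assms by (auto simp: fractional_def)
  have "(1 - b2) * ((1 - b1) + (1 - b2)) \<le> (1 - b2) * 1"
    using b False by (intro mult_left_mono) auto
  then have "1 - b2 \<le> ?q"
    using b by (simp add: pos_le_divide_eq)
  then have "min b2 (1 - b2) \<le> ?q"
    by linarith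
  moreover have q: "?q * ((1 - b1) + (1 - b2)) = 1 - b2"
    using b by simp
  have "?q * 1 + (1 - ?q) * (b1 + b2 - 1) = b1" "(1 - ?q) * 1 + ?q * (b1 + b2 - 1) = b2"
    using q by algebra+
  ultimately show thesis
    using b False
    by (intro that[where q = ?q and v = 1 and c = "b1 + b2 - 1"]) (auto simp: simplify_def)
qed

lemma finite_set_pmf_dep_round_loop: "finite (set_pmf (dep_round_loop \<pi> X))"
proof (induction \<pi> X rule: dep_round_loop.induct)
  case (1 \<pi> X)
  have "finite (set_pmf (simplify a b))" for a b
    by (simp add: simplify_def)
  with 1 show ?case
    by (subst dep_round_loop.simps) (fastforce simp: fun_upd_def split: list.split)
qed

lemma expectation_dep_round_loop_step:
  assumes "filter (\<lambda>i. fractional (X i)) (remdups \<pi>) = i # j # L"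
    and "simplify (X i) (X j) = map_pmf (\<lambda>h. if h then (v, c) else (c, v)) (bernoulli_pmf q)"
    and "0 \<le> q" "q \<le> 1"
  shows "measure_pmf.expectation (dep_round_loop \<pi> X) (f :: _ \<Rightarrow> real) =
    q * measure_pmf.expectation (dep_round_loop \<pi> (X(i := v, j := c))) f +
    (1 - q) * measure_pmf.expectation (dep_round_loop \<pi> (X(i := c, j := v))) f"
proof -
  have "dep_round_loop \<pi> X = bind_pmf (bernoulli_pmf q)
      (\<lambda>h. dep_round_loop \<pi> (if h then X(i := v, j := c) else X(i := c, j := v)))"
    using assms(1,2)
    by (subst dep_round_loop.simps) (auto simp: bind_map_pmf intro!: bind_pmf_cong)
  then show ?thesis
    using assms(3,4) pmf_expectation_bind[of UNIV
      "\<lambda>h. dep_round_loop \<pi> (if h then X(i := v, j := c) else X(i := c, j := v))" "bernoulli_pmf q" f]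
    by (simp add: finite_set_pmf_dep_round_loop UNIV_bool subset_iff)
qed

section \<open>Lower bound for a fixed processing order\<close>

locale signed_indices =
  fixes Ip Im :: "nat set" and p :: "nat \<Rightarrow> real" and \<alpha> :: real
  assumes \<alpha>_pos: "0 < \<alpha>" and \<alpha>_less_1: "\<alpha> < 1"
begin

text \<open>The value 1 outside \<open>Ip \<union> Im\<close> lets the product range over the whole
  order; being affine in \<open>x\<close>, the mean of each factor is kept by a step.\<close>

definition literal :: "nat \<Rightarrow> real \<Rightarrow> real" where
  "literal i x = (if i \<in> Ip then x else if i \<in> Im then 1 - x else 1)"

lemma literal_nonneg: "0 \<le> x \<Longrightarrow> x \<le> 1 \<Longrightarrow> 0 \<le> literal i x"
  and literal_ge: "\<alpha> \<le> x \<Longrightarrow> x \<le> 1 - \<alpha> \<Longrightarrow> \<alpha> \<le> literal i x"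
  and literal_notin: "i \<notin> Ip \<union> Im \<Longrightarrow> literal i x = 1"
  and literal_convex: "literal i (q * x + (1 - q) * y) = q * literal i x + (1 - q) * literal i y"
  using \<alpha>_less_1 by (auto simp: literal_def algebra_simps)

text \<open>
  Bounds the probability that the current survivor is still undecided when the next literal
  in the list is reached. It is 0 if there is none, since then nothing is lost.
\<close>

primrec survival :: "nat list \<Rightarrow> real" where
  "survival [] = 0"
| "survival (j # js) = (if j \<in> Ip \<union> Im then 1 else (1 - \<alpha>) * survival js)"

text \<open>Each literal pays for the chance of still being the survivor when the next one comes.
  Dividing by \<alpha> makes this loss relative to the literal, and truncation at 0 keeps the bound
  nonnegative in orders with literals too close together.\<close>

primrec guarantee :: "nat list \<Rightarrow> real" where
  "guarantee [] = 1"
| "guarantee (j # js) =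
    (if j \<in> Ip \<union> Im then literal j (p j) * max 0 (1 - survival js / \<alpha>) else 1) * guarantee js"

text \<open>For the head the loss is absolute: its current value may make the literal arbitrarily
  small, and a difference affine in \<open>x\<close> can be averaged over the two outcomes of a
  step.\<close>

definition head_factor :: "nat \<Rightarrow> real \<Rightarrow> nat list \<Rightarrow> real" where
  "head_factor c x js = (if c \<in> Ip \<union> Im then literal c x - survival js else 1)"

lemma survival_nonneg: "0 \<le> survival js"
  using \<alpha>_less_1 by (induction js) auto

lemma guarantee_nonneg: "(\<And>i. i \<in> set js \<Longrightarrow> 0 \<le> p i \<and> p i \<le> 1) \<Longrightarrow> 0 \<le> guarantee js"
  by (induction js) (auto simp: literal_nonneg)

lemma head_factor_le_literal: "head_factor c x js \<le> literal c x"
  using survival_nonneg[of js] by (auto simp: head_factor_def literal_notin)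

text \<open>Turns the absolute loss of \<open>head_factor\<close> into the relative one of
  \<open>guarantee\<close>, since the literal of an unprocessed index is at least \<alpha>. The
  scalar \<open>r\<close> stands for the probability that a newly reached index becomes the
  survivor, or for 1 when it is the head for sure.\<close>

lemma survival_div_le:
  assumes "\<alpha> \<le> x" "x \<le> 1 - \<alpha>" "0 \<le> r" "r \<le> 1"
  shows "literal i x * (1 - survival js / \<alpha>) \<le> literal i x - r * survival js"
proof -
  have "r * survival js * \<alpha> \<le> 1 * survival js * literal i x"
    using assms literal_ge[of x i] survival_nonneg[of js] \<alpha>_pos by (intro mult_mono) auto
  then have "r * survival js \<le> literal i x * survival js / \<alpha>"
    using \<alpha>_pos by (simp add: pos_le_divide_eq mult.commute)
  then show ?thesis
    by (simp add: right_diff_distrib)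
qed

text \<open>
  A decided head \<open>c\<close> is kept as if it were the survivor: then both a fresh start of the list and
  the case in which two entries sum to 1 are covered by the same induction.
\<close>

lemma expectation_dep_round_loop_ge:
  fixes X :: "nat \<Rightarrow> real"
  assumes "distinct \<pi>" "distinct (c # js)" "set (c # js) \<subseteq> set \<pi>"
    and "filter (\<lambda>i. fractional (X i)) \<pi> = filter (\<lambda>i. fractional (X i)) (c # js)"
    and "\<And>i. i \<in> set \<pi> \<Longrightarrow> 0 \<le> X i \<and> X i \<le> 1"
    and "\<And>i. i \<in> set js \<Longrightarrow> X i = p i \<and> \<alpha> \<le> p i \<and> p i \<le> 1 - \<alpha>"
  defines "E \<equiv> \<lambda>X. measure_pmf.expectation (dep_round_loop \<pi> X) (\<lambda>X. \<Prod>i\<in>set \<pi>. literal i (X i))"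
  shows "0 \<le> E X \<and>
    (\<Prod>i\<in>set \<pi> - set (c # js). literal i (X i)) * head_factor c (X c) js * guarantee js \<le> E X"
  using assms(2-6)
proof (induction js arbitrary: c X)
  case Nil
  have "dep_round_loop \<pi> X = return_pmf X"
    using Nil assms(1) by (subst dep_round_loop.simps) (auto simp: distinct_remdups_id)
  then have E: "E X = (\<Prod>i\<in>set \<pi>. literal i (X i))"
    by (simp add: E_def)
  also have "\<dots> = literal c (X c) * (\<Prod>i\<in>set \<pi> - {c}. literal i (X i))"
    using Nil by (simp add: prod.remove)
  finally have "E X = literal c (X c) * (\<Prod>i\<in>set \<pi> - {c}. literal i (X i))" .
  moreover have "0 \<le> E X"
    unfolding E using Nil(4) by (intro prod_nonneg literal_nonneg) auto
  ultimately show ?case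
    by (auto simp: head_factor_def literal_notin)
next
  case (Cons j js)
  \<comment> \<open>By the filter hypothesis these indices are already decided, so \<open>Q\<close>
    stays the same through the step.\<close>
  define Q where "Q = (\<Prod>i\<in>set \<pi> - set (c # j # js). literal i (X i))"
  have Q: "Q \<ge> 0"
    unfolding Q_def using Cons.prems by (auto intro!: prod_nonneg literal_nonneg)
  have pj: "X j = p j" "\<alpha> \<le> p j" "p j \<le> 1 - \<alpha>"
    using Cons.prems by auto
  have fj: "fractional (X j)"
    using pj \<alpha>_pos by (auto simp: fractional_def)
  have G: "0 \<le> guarantee js"
  proof (rule guarantee_nonneg)
    fix i assume "i \<in> set js"
    then have "\<alpha> \<le> p i \<and> p i \<le> 1 - \<alpha>" using Cons.prems(5) by auto
    then show "0 \<le> p i \<and> p i \<le> 1" using \<alpha>_pos by linarith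
  qed
  \<comment> \<open>Whichever of \<open>c\<close> and \<open>j\<close> leaves the list joins the
    decided indices.\<close>
  have insert_prod: "(\<Prod>i\<in>set \<pi> - set (k # js). literal i (Y i)) = literal k' (Y k') * Q"
    if "k = c \<and> k' = j \<or> k = j \<and> k' = c" "\<And>i. i \<notin> {c, j} \<Longrightarrow> Y i = X i" for k k' Y
  proof -
    have "set \<pi> - set (k # js) = insert k' (set \<pi> - set (c # j # js))"
      using that Cons.prems by auto
    moreover have "k' \<notin> set \<pi> - set (c # j # js)"
      using that by auto
    moreover have "(\<Prod>i\<in>set \<pi> - set (c # j # js). literal i (Y i)) = Q"
      unfolding Q_def using that(2) by (intro prod.cong) auto
    ultimately show ?thesis by simp
  qed
  show ?case
  proof (cases "fractional (X c)")
    case False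
    \<comment> \<open>No rounding takes place here: the loop skips the decided \<open>c\<close>, so
      the same state is viewed with \<open>j\<close> as head.\<close>
    have "0 \<le> E X \<and>
      (\<Prod>i\<in>set \<pi> - set (j # js). literal i (X i)) * head_factor j (X j) js * guarantee js \<le> E X"
      using Cons.prems False by (intro Cons.IH) auto
    then have E: "0 \<le> E X" "literal c (X c) * Q * head_factor j (p j) js * guarantee js \<le> E X"
      using insert_prod[of j c X] Cons.prems(1) pj by auto
    define g where "g = (if j \<in> Ip \<union> Im then literal j (p j) * max 0 (1 - survival js / \<alpha>) else 1)"
    have "Q * head_factor c (X c) (j # js) * g * guarantee js \<le> E X"
    \<comment> \<open>Where the truncation makes \<open>g\<close> vanish, nonnegativity of the
      expectation suffices; hence its place in the induction claim.\<close>
    proof (cases "g = 0")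
      case True
      then show ?thesis using E by simp
    next
      case g0: False
      have lit: "0 \<le> literal j (p j)" using literal_ge[of "p j" j] pj \<alpha>_pos by linarith
      have "g \<le> head_factor j (p j) js"
        using g0 survival_div_le[of "p j" 1 j js] pj by (auto simp: g_def head_factor_def max_def)
      moreover have "0 \<le> g" using lit by (auto simp: g_def)
      moreover have "0 \<le> literal c (X c)"
        using Cons.prems by (intro literal_nonneg) auto
      ultimately have "head_factor c (X c) (j # js) * g \<le> literal c (X c) * head_factor j (p j) js"
        using head_factor_le_literal by (intro mult_mono) auto
      then have "Q * guarantee js * (head_factor c (X c) (j # js) * g)
          \<le> Q * guarantee js * (literal c (X c) * head_factor j (p j) js)"
        using Q G by (intro mult_left_mono) auto
      then show ?thesis using E(2) by (simp add: mult_ac)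
    qed
    then show ?thesis
      using E(1) unfolding guarantee.simps g_def[symmetric] Q_def by (simp add: mult_ac)
  next
    case True
    obtain q v b where s:
      "simplify (X c) (X j) = map_pmf (\<lambda>h. if h then (v, b) else (b, v)) (bernoulli_pmf q)"
      and qge: "min (X j) (1 - X j) \<le> q" and q: "0 \<le> q" "q \<le> 1"
      and v: "v = 0 \<or> v = 1" and b: "0 \<le> b" "b \<le> 1"
      and Xc: "q * v + (1 - q) * b = X c" and Xj: "(1 - q) * v + q * b = X j"
      using simplify_fractional[OF True fj] by metis
    have cj: "c \<noteq> j" "c \<notin> set js" "j \<notin> set js" "c \<in> set \<pi>" "j \<in> set \<pi>"
      using Cons.prems by auto
    have fjs: "filter (\<lambda>i. fractional (X i)) js = js"
      using Cons.prems(5) \<alpha>_pos by (fastforce simp: filter_id_conv fractional_def)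
    have fil: "filter (\<lambda>i. fractional (X i)) \<pi> = c # j # js"
      using Cons.prems(3) True fj fjs by simp
    \<comment> \<open>A step alters only \<open>c\<close> and \<open>j\<close>, both fractional
      before, so no index becomes fractional anew.\<close>
    have filter_upd: "filter (\<lambda>i. fractional (Y i)) \<pi> = filter (\<lambda>i. fractional (Y i)) (c # j # js)"
      if "\<And>i. i \<notin> {c, j} \<Longrightarrow> Y i = X i" for Y
    proof -
      have "filter (\<lambda>i. fractional (Y i)) \<pi> =
          filter (\<lambda>i. fractional (X i) \<and> fractional (Y i)) \<pi>"
        using that True fj by (intro filter_cong) (auto, metis)
      also have "\<dots> = filter (\<lambda>i. fractional (Y i)) (filter (\<lambda>i. fractional (X i)) \<pi>)"
        by (simp add: conj_commute)
      finally show ?thesis using fil by simp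
    qed
    have fv: "\<not> fractional v" using v by (auto simp: fractional_def)
    define Y1 where "Y1 = X(c := v, j := b)"
    define Y2 where "Y2 = X(c := b, j := v)"
    have E: "E X = q * E Y1 + (1 - q) * E Y2"
      unfolding E_def Y1_def Y2_def
      using fil assms(1) s q
      by (intro expectation_dep_round_loop_step) (auto simp: distinct_remdups_id)
    have f1: "filter (\<lambda>i. fractional (Y1 i)) \<pi> = filter (\<lambda>i. fractional (Y1 i)) (j # js)"
      using filter_upd[of Y1] cj fv by (auto simp: Y1_def)
    have f2: "filter (\<lambda>i. fractional (Y2 i)) \<pi> = filter (\<lambda>i. fractional (Y2 i)) (c # js)"
      using filter_upd[of Y2] cj fv by (auto simp: Y2_def)
    \<comment> \<open>With probability \<open>q\<close> the head is decided and \<open>j\<close>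
      becomes the survivor; \<open>b\<close> may itself be 0 or 1, which the induction claim
      allows.\<close>
    have "0 \<le> E Y1 \<and>
      (\<Prod>i\<in>set \<pi> - set (j # js). literal i (Y1 i)) * head_factor j (Y1 j) js * guarantee js \<le> E Y1"
      using Cons.prems f1 v b cj
      by (intro Cons.IH) (auto simp: Y1_def)
    then have E1: "0 \<le> E Y1" "Q * (literal c v * head_factor j b js * guarantee js) \<le> E Y1"
      using insert_prod[of j c Y1] cj by (auto simp: Y1_def mult_ac)
    have "0 \<le> E Y2 \<and>
      (\<Prod>i\<in>set \<pi> - set (c # js). literal i (Y2 i)) * head_factor c (Y2 c) js * guarantee js \<le> E Y2"
      using Cons.prems f2 v b cj
      by (intro Cons.IH) (auto simp: Y2_def)
    then have E2: "0 \<le> E Y2" "Q * (literal j v * head_factor c b js * guarantee js) \<le> E Y2"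
      using insert_prod[of c j Y2] cj by (auto simp: Y2_def mult_ac)
    have E0: "0 \<le> E X" using E E1 E2 q by simp
    have "Q * guarantee js *
        (q * (literal c v * head_factor j b js) + (1 - q) * (literal j v * head_factor c b js))
      = q * (Q * (literal c v * head_factor j b js * guarantee js)) +
        (1 - q) * (Q * (literal j v * head_factor c b js * guarantee js))"
      by (simp add: algebra_simps)
    also have "\<dots> \<le> E X"
      unfolding E using E1 E2 q by (intro add_mono mult_left_mono) auto
    finally have step: "Q * guarantee js *
        (q * (literal c v * head_factor j b js) + (1 - q) * (literal j v * head_factor c b js)) \<le> E X" .
    have q\<alpha>: "\<alpha> \<le> q" using qge pj by linarith
    define g where "g = (if j \<in> Ip \<union> Im then literal j (p j) * max 0 (1 - survival js / \<alpha>) else 1)"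
    have litc: "literal c (X c) = q * literal c v + (1 - q) * literal c b"
      using literal_convex[of c q v b] Xc by simp
    have litj: "literal j (p j) = (1 - q) * literal j v + q * literal j b"
      using literal_convex[of j q b v] Xj pj by (simp add: add.commute)
    have QG: "Q * guarantee js * (head_factor c (X c) (j # js) * g) \<le> E X"
    proof (cases "head_factor c (X c) (j # js) * g \<le> 0")
      case True
      then have "Q * guarantee js * (head_factor c (X c) (j # js) * g) \<le> 0"
        using Q G by (intro mult_nonneg_nonpos[OF mult_nonneg_nonneg])
      then show ?thesis using E0 by linarith
    next
      case pos: False
      have "head_factor c (X c) (j # js) * g \<le>
        q * (literal c v * head_factor j b js) + (1 - q) * (literal j v * head_factor c b js)"
      proof (cases "j \<in> Ip \<union> Im")
        case True
        have "0 \<le> g"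
          using True literal_ge[of "p j" j] pj \<alpha>_pos by (auto simp: g_def)
        \<comment> \<open>If two literals met, the survival bound would be 1 and the head factor at
          most 0, contrary to the positive product.\<close>
        have "c \<notin> Ip \<union> Im"
        proof
          assume "c \<in> Ip \<union> Im"
          moreover have "literal c (X c) \<le> 1"
            using Cons.prems(4)[OF cj(4)] by (auto simp: literal_def)
          ultimately have "head_factor c (X c) (j # js) \<le> 0"
            using True by (auto simp: head_factor_def)
          then show False
            using pos \<open>0 \<le> g\<close> by (auto simp: mult_nonpos_nonneg)
        qed
        \<comment> \<open>The right-hand side is the average over both outcomes: the loss arises
          only if \<open>j\<close> becomes the survivor, which has probability
          \<open>q\<close>.\<close>
        moreover have "g \<le> literal j (p j) - q * survival js"
          using pos True survival_div_le[OF pj(2,3) q, of j js] by (auto simp: g_def max_def split: if_splits)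
        ultimately show ?thesis
          using True litj by (simp add: head_factor_def literal_notin algebra_simps)
      next
        case False
        \<comment> \<open>The head outlives an index that is no literal with probability
          \<open>1 - q\<close>, at most the factor charged by \<open>survival\<close>.\<close>
        have "(1 - q) * survival js \<le> (1 - \<alpha>) * survival js"
          using q\<alpha> survival_nonneg by (intro mult_right_mono) auto
        then show ?thesis
          using False litc by (auto simp: head_factor_def literal_notin g_def algebra_simps)
      qed
      then have "Q * guarantee js * (head_factor c (X c) (j # js) * g) \<le> Q * guarantee js *
        (q * (literal c v * head_factor j b js) + (1 - q) * (literal j v * head_factor c b js))"
        using Q G by (intro mult_left_mono) auto
      then show ?thesis using step by linarith
    qed
    then show ?thesis
      using E0 unfolding guarantee.simps g_def[symmetric] Q_def by (simp add: mult_ac)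
  qed
qed

text \<open>The induction is started with the first entry as head and no index set aside. The head
  still has its original value \<open>p c\<close>, so its absolute loss becomes a relative
  one.\<close>

lemma expectation_dep_round_loop_ge_guarantee:
  assumes "distinct \<pi>" "\<And>i. i \<in> set \<pi> \<Longrightarrow> \<alpha> \<le> p i \<and> p i \<le> 1 - \<alpha>"
  defines "E \<equiv> measure_pmf.expectation (dep_round_loop \<pi> p) (\<lambda>X. \<Prod>i\<in>set \<pi>. literal i (X i))"
  shows "0 \<le> E" "guarantee \<pi> \<le> E"
proof -
  have "0 \<le> E \<and> guarantee \<pi> \<le> E"
  proof (cases \<pi>)
    case Nil
    then show ?thesis by (simp add: E_def dep_round_loop.simps)
  next
    case (Cons c js)
    have p01: "0 \<le> p i \<and> p i \<le> 1" if "i \<in> set \<pi>" for i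
      using assms(2)[OF that] \<alpha>_pos by linarith
    have pc: "\<alpha> \<le> p c" "p c \<le> 1 - \<alpha>"
      using assms(2) Cons by auto
    have *: "0 \<le> E \<and> head_factor c (p c) js * guarantee js \<le> E"
      using expectation_dep_round_loop_ge[of \<pi> c js p] assms(1,2) p01 Cons
      by (simp add: E_def)
    have G: "0 \<le> guarantee js"
      using p01 Cons by (intro guarantee_nonneg) auto
    consider "c \<notin> Ip \<union> Im" | "c \<in> Ip \<union> Im" "1 - survival js / \<alpha> \<le> 0"
      | "c \<in> Ip \<union> Im" "1 - survival js / \<alpha> > 0" by linarith
    then show ?thesis
    proof cases
      case 1
      then show ?thesis using * Cons by (simp add: head_factor_def)
    next
      case 2
      then show ?thesis using * Cons by (auto simp: max_def)
    next
      case 3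
      then have "literal c (p c) * (1 - survival js / \<alpha>) * guarantee js \<le> head_factor c (p c) js * guarantee js"
        using survival_div_le[OF pc, of 1 c js] G by (intro mult_right_mono) (auto simp: head_factor_def)
      then show ?thesis using * Cons 3 by (auto simp: max_def)
    qed
  qed
  then show "0 \<le> E" "guarantee \<pi> \<le> E" by auto
qed

end

section \<open>Orders in which the literals are far apart\<close>

text \<open>\<open>g\<close> is the debt of elements outside \<open>J\<close> still owed before the
  next element of \<open>J\<close> may come. Subtraction stops at 0, so larger gaps are allowed, and
  a debt may remain at the end of the list.\<close>

fun separated :: "'a set \<Rightarrow> nat \<Rightarrow> nat \<Rightarrow> 'a list \<Rightarrow> bool" where
  "separated J d g [] = True"
| "separated J d g (x # xs) =
    (if x \<in> J then g = 0 \<and> separated J d d xs else separated J d (g - 1) xs)"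

context signed_indices
begin

text \<open>At least \<open>g\<close> elements precede the next literal, each giving a factor
  \<open>1 - \<alpha>\<close>; without a next literal the survival is 0.\<close>

lemma survival_le:
  "separated (Ip \<union> Im) d g js \<Longrightarrow> survival js \<le> (1 - \<alpha>) ^ g"
proof (induction js arbitrary: g)
  case (Cons j js)
  show ?case
  proof (cases "j \<in> Ip \<union> Im")
    case False
    then have "survival (j # js) \<le> (1 - \<alpha>) * (1 - \<alpha>) ^ (g - 1)"
      using Cons \<alpha>_less_1 by auto
    also have "\<dots> \<le> (1 - \<alpha>) ^ g"
      using \<alpha>_pos by (cases g) auto
    finally show ?thesis .
  qed (use Cons in auto)
qed (use \<alpha>_less_1 in auto)

lemma survival_eq_0: "set js \<inter> (Ip \<union> Im) = {} \<Longrightarrow> survival js = 0"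
  by (induction js) auto

text \<open>Each literal followed by another keeps at least the stated factor, while the last one
  loses nothing; hence an exponent one below the number of literals.\<close>

lemma guarantee_ge:
  assumes "separated (Ip \<union> Im) d g js" "distinct js" "(1 - \<alpha>) ^ d \<le> \<alpha>"
    and "\<And>i. i \<in> set js \<Longrightarrow> 0 \<le> p i \<and> p i \<le> 1"
  shows "(1 - (1 - \<alpha>) ^ d / \<alpha>) ^ (card (set js \<inter> (Ip \<union> Im)) - 1) * (\<Prod>i\<in>set js. literal i (p i))
    \<le> guarantee js"
  using assms
proof (induction js arbitrary: g)
  case (Cons j js)
  let ?J = "Ip \<union> Im" and ?\<kappa> = "1 - (1 - \<alpha>) ^ d / \<alpha>"
  let ?B = "?\<kappa> ^ (card (set js \<inter> ?J) - 1) * (\<Prod>i\<in>set js. literal i (p i))"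
  have \<kappa>: "0 \<le> ?\<kappa>"
    using Cons.prems(3) \<alpha>_pos by simp
  have B: "0 \<le> ?B"
    using \<kappa> Cons.prems(4) by (intro mult_nonneg_nonneg prod_nonneg zero_le_power) (auto simp: literal_nonneg)
  show ?case
  proof (cases "j \<in> ?J")
    case False
    have IH: "?B \<le> guarantee js"
      using Cons.prems False by (intro Cons.IH[of "g - 1"]) auto
    then show ?thesis
      using False Cons.prems by (simp add: literal_notin)
  next
    case True
    have sep: "separated ?J d d js"
      using Cons.prems(1) True by (simp split: if_splits)
    then have IH: "?B \<le> guarantee js"
      using Cons.prems by (intro Cons.IH[of d]) auto
    have lit: "0 \<le> literal j (p j)"
      using Cons.prems(4) by (simp add: literal_nonneg)
    have card: "card (set (j # js) \<inter> ?J) - 1 = card (set js \<inter> ?J)"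
      using True Cons.prems(2) by simp
    have "?\<kappa> ^ card (set js \<inter> ?J) * (\<Prod>i\<in>set js. literal i (p i))
        \<le> max 0 (1 - survival js / \<alpha>) * guarantee js"
    \<comment> \<open>With no later literal the survival is 0 and both exponents vanish, the one in
      \<open>?B\<close> by truncated subtraction.\<close>
    proof (cases "set js \<inter> ?J = {}")
      case True
      then show ?thesis using IH by (simp add: survival_eq_0)
    next
      case False
      then have "0 < card (set js \<inter> ?J)"
        by (simp add: card_gt_0_iff)
      then have "?\<kappa> ^ card (set js \<inter> ?J) = ?\<kappa> * ?\<kappa> ^ (card (set js \<inter> ?J) - 1)"
        using power_minus_mult[of "card (set js \<inter> ?J)" ?\<kappa>] by (simp only: mult.commute)
      then have "?\<kappa> ^ card (set js \<inter> ?J) * (\<Prod>i\<in>set js. literal i (p i)) = ?\<kappa> * ?B"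
        by (simp only: mult.assoc)
      also have "?\<kappa> \<le> 1 - survival js / \<alpha>"
        using survival_le[OF sep] \<alpha>_pos by (simp add: divide_right_mono)
      then have "?\<kappa> * ?B \<le> max 0 (1 - survival js / \<alpha>) * guarantee js"
        using IH B \<kappa> by (intro mult_mono) auto
      finally show ?thesis .
    qed
    then have "literal j (p j) * (?\<kappa> ^ card (set js \<inter> ?J) * (\<Prod>i\<in>set js. literal i (p i)))
        \<le> literal j (p j) * (max 0 (1 - survival js / \<alpha>) * guarantee js)"
      using lit by (rule mult_left_mono)
    then show ?thesis
      using True Cons.prems(2) unfolding card by (simp add: mult_ac)
  qed
qed simp

end

section \<open>Counting the separated orders\<close>

lemma card_permutations_of_set_filter_Cons:
  assumes "finite A" "A \<noteq> {}"
  shows "card {\<pi> \<in> permutations_of_set A. P \<pi>} =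
    (\<Sum>x\<in>A. card {\<pi> \<in> permutations_of_set (A - {x}). P (x # \<pi>)})"
proof -
  have "{\<pi> \<in> permutations_of_set A. P \<pi>} =
      (\<Union>x\<in>A. (#) x ` {\<pi> \<in> permutations_of_set (A - {x}). P (x # \<pi>)})"
    by (subst permutations_of_set_nonempty[OF assms(2)]) auto
  also have "card \<dots> = (\<Sum>x\<in>A. card ((#) x ` {\<pi> \<in> permutations_of_set (A - {x}). P (x # \<pi>)}))"
    using assms(1) by (intro card_UN_disjoint) auto
  finally show ?thesis
    by (simp add: card_image)
qed

text \<open>Deleting \<open>g\<close> entries in front and \<open>d\<close> from each gap between
  consecutive elements of \<open>J\<close> leaves a free choice of positions; the factorials arrange
  the two groups. Fixing the first entry gives a recursion matched by Pascal's rule.\<close>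

lemma card_separated_permutations:
  assumes "finite A"
  shows "fact (card (A \<inter> J)) * fact (card (A - J)) *
      ((card A - g - (card (A \<inter> J) - 1) * d) choose card (A \<inter> J))
    \<le> card {\<pi> \<in> permutations_of_set A. separated J d g \<pi>}"
  using assms
proof (induction "card A" arbitrary: A g rule: less_induct)
  case less
  let ?N = "\<lambda>A g. card {\<pi> \<in> permutations_of_set A. separated J d g \<pi>}"
  let ?F = "\<lambda>u t g. fact t * fact u * ((u + t - g - (t - 1) * d) choose t) :: nat"
  define t u where "t = card (A \<inter> J)" and "u = card (A - J)"
  have card_A: "card B = card (B - J) + card (B \<inter> J)" if "finite B" for B
    using that by (metis add.commute card_Int_Diff)
  have IH: "?F (card (B - J)) (card (B \<inter> J)) h \<le> ?N B h" if "B \<subset> A" for B h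
  proof -
    have "finite B"
      using that less.prems by (auto intro: finite_subset)
    then show ?thesis
      using less.hyps[of B h] psubset_card_mono[OF less.prems that] card_A[of B] by simp
  qed
  have tu: "card A = u + t" using card_A[OF less.prems] by (simp add: t_def u_def)
  have "?F u t g \<le> ?N A g"
  proof (cases "A = {}")
    case True
    then have "{\<pi> \<in> permutations_of_set A. separated J d g \<pi>} = {[]}" by auto
    then show ?thesis by (simp add: t_def u_def True)
  next
    case False
    have "?N A g = (\<Sum>x\<in>A. card {\<pi> \<in> permutations_of_set (A - {x}). separated J d g (x # \<pi>)})"
      using less.prems False by (rule card_permutations_of_set_filter_Cons)
    also have "\<dots> = (\<Sum>x\<in>A - J. card {\<pi> \<in> permutations_of_set (A - {x}). separated J d g (x # \<pi>)}) +
        (\<Sum>x\<in>A \<inter> J. card {\<pi> \<in> permutations_of_set (A - {x}). separated J d g (x # \<pi>)})"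
      using sum.Int_Diff[OF less.prems, of _ J] by (simp only: add.commute)
    also have "\<dots> = (\<Sum>x\<in>A - J. ?N (A - {x}) (g - 1)) +
        (\<Sum>x\<in>A \<inter> J. if g = 0 then ?N (A - {x}) d else 0)"
      by (intro arg_cong2[of _ _ _ _ "(+)"] sum.cong) auto
    finally have N: "?N A g = \<dots>" .
    have "u * ?F (u - 1) t (g - 1) = (\<Sum>x\<in>A - J. ?F (u - 1) t (g - 1))"
      by (simp add: u_def)
    also have "\<dots> \<le> (\<Sum>x\<in>A - J. ?N (A - {x}) (g - 1))"
    proof (rule sum_mono)
      fix x assume x: "x \<in> A - J"
      then have "(A - {x}) - J = (A - J) - {x}" "(A - {x}) \<inter> J = A \<inter> J" "A - {x} \<subset> A" by auto
      then show "?F (u - 1) t (g - 1) \<le> ?N (A - {x}) (g - 1)"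
        using IH[of "A - {x}" "g - 1"] x less.prems by (simp add: t_def u_def)
    qed
    finally have N1: "u * ?F (u - 1) t (g - 1) \<le> (\<Sum>x\<in>A - J. ?N (A - {x}) (g - 1))" .
    have "t * ?F u (t - 1) d = (\<Sum>x\<in>A \<inter> J. ?F u (t - 1) d)"
      by (simp add: t_def)
    also have "\<dots> \<le> (\<Sum>x\<in>A \<inter> J. ?N (A - {x}) d)"
    proof (rule sum_mono)
      fix x assume x: "x \<in> A \<inter> J"
      then have "(A - {x}) - J = A - J" "(A - {x}) \<inter> J = (A \<inter> J) - {x}" "A - {x} \<subset> A" by auto
      then show "?F u (t - 1) d \<le> ?N (A - {x}) d"
        using IH[of "A - {x}" d] x less.prems by (simp add: t_def u_def)
    qed
    finally have N2: "t * ?F u (t - 1) d \<le> (\<Sum>x\<in>A \<inter> J. ?N (A - {x}) d)" .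
    have "?F u t g \<le> u * ?F (u - 1) t (g - 1) + (if g = 0 then t * ?F u (t - 1) d else 0)"
    proof (cases t)
      case 0
      then have "0 < u" using False less.prems tu by (cases u) auto
      then show ?thesis using 0 by (cases u) auto
    next
      case (Suc k)
      show ?thesis
      proof (cases "u + t - g - k * d < t")
        case True
        then show ?thesis using Suc by (simp add: binomial_eq_0)
      next
        case large: False
        show ?thesis
        proof (cases g)
          case (Suc g')
          \<comment> \<open>A debt forces an entry outside \<open>J\<close>; \<open>u\<close> and
            \<open>g\<close> drop together, so the binomial coefficient does not change.\<close>
          then obtain u' where u: "u = Suc u'" using large \<open>t = Suc k\<close> by (cases u) auto
          then show ?thesis using Suc by (simp add: algebra_simps)
        next
          case 0
          \<comment> \<open>One less than the number of available positions, so that Pascal's rule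
            splits \<open>Suc m choose t\<close>.\<close>
          define m where "m = u + k - k * d"
          have m: "u + t - g - (t - 1) * d = Suc m"
            using large 0 Suc by (simp add: m_def)
          \<comment> \<open>For \<open>k = 0\<close> the upper arguments may differ, but both
            coefficients are 1.\<close>
          have "(u + (t - 1) - d - (t - 1 - 1) * d) choose (t - 1) = m choose k"
            using Suc by (cases k) (auto simp: m_def)
          then have F2: "t * ?F u (t - 1) d = fact t * fact u * (m choose k)"
            using Suc by (simp add: algebra_simps)
          show ?thesis
          proof (cases u)
            case u0: 0
            \<comment> \<open>With no entry outside \<open>J\<close>, enough room forces
              \<open>k * d = 0\<close>.\<close>
            have "m = k" using large 0 Suc u0 by (simp add: m_def)
            then show ?thesis using F2 0 m Suc by simp
          next
            case (Suc u')
            have "(u - 1) + t - (g - 1) - (t - 1) * d = m"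
              using 0 Suc \<open>t = Suc k\<close> by (simp add: m_def)
            then have "u * ?F (u - 1) t (g - 1) = fact t * fact u * (m choose t)"
              using Suc by (simp add: algebra_simps)
            then have "u * ?F (u - 1) t (g - 1) + t * ?F u (t - 1) d
                = fact t * fact u * (Suc m choose t)"
              using F2 \<open>t = Suc k\<close> by (simp only: binomial_Suc_Suc add_mult_distrib2 add.commute)
            then show ?thesis using 0 m by simp
          qed
        qed
      qed
    qed
    also have "\<dots> \<le> ?N A g"
      unfolding N using N1 N2 by (intro add_mono) auto
    finally show ?thesis .
  qed
  then show ?case by (simp add: tu t_def u_def)
qed

text \<open>As products of \<open>t\<close> quotients the two sides compare factor by factor: taking
  at most \<open>t * d\<close> from \<open>n - i\<close> costs at most the fraction
  \<open>t * d / (n - t)\<close>, as \<open>n - i\<close> exceeds \<open>n - t\<close> for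
  \<open>i < t\<close>.\<close>

lemma binomial_shift_ge:
  fixes n t d :: nat
  assumes "t \<ge> 1" "t < n" "t * d \<le> n - t"
  shows "(1 - real t * real d / (real n - real t)) ^ t * real (n choose t)
    \<le> real ((n - (t - 1) * d) choose t)"
proof -
  let ?r = "1 - real t * real d / (real n - real t)" and ?m = "n - (t - 1) * d"
  have td: "real t * real d \<le> real n - real t"
    using assms by (metis less_imp_le_nat of_nat_diff of_nat_le_iff of_nat_mult)
  have r: "0 \<le> ?r" using td assms by simp
  have td': "(t - 1) * d \<le> t * d" by simp
  have tm: "t \<le> ?m" using assms td' by linarith
  have "?r * real (n - i) \<le> real (?m - i)" if "i < t" for i
  proof -
    have "1 \<le> real (n - i) / (real n - real t)"
      using that assms(2) by (subst pos_le_divide_eq) (simp_all add: of_nat_diff)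
    then have "real t * real d * 1 \<le> real t * real d * (real (n - i) / (real n - real t))"
      by (rule mult_left_mono) simp
    then have "?r * real (n - i) \<le> real (n - i) - real t * real d"
      by (simp only: left_diff_distrib mult_1 mult_1_right times_divide_eq_left times_divide_eq_right diff_left_mono)
    also have "\<dots> \<le> real (n - i) - real ((t - 1) * d)"
      using td' by (metis diff_left_mono of_nat_le_iff of_nat_mult)
    also have "\<dots> = real (n - i - (t - 1) * d)"
      using that tm by (intro of_nat_diff[symmetric]) linarith
    also have "n - i - (t - 1) * d = ?m - i"
      by (rule diff_commute)
    finally show ?thesis .
  qed
  then have "(\<Prod>i<t. ?r * (real (n - i) / real (t - i))) \<le> (\<Prod>i<t. real (?m - i) / real (t - i))"
    using r by (intro prod_mono) (auto simp: divide_right_mono)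
  moreover have binom: "real (a choose t) = (\<Prod>i<t. real (a - i) / real (t - i))" if "t \<le> a" for a
    using that by (simp add: binomial_altdef_of_nat atLeast0LessThan of_nat_diff)
  ultimately show ?thesis
    unfolding binom[OF tm] binom[OF less_imp_le[OF assms(2)]]
    by (simp only: prod.distrib prod_constant card_lessThan)
qed

section \<open>Averaging over the random order\<close>

theorem theorem2p14:
  fixes n t :: nat and p :: "nat \<Rightarrow> real" and \<alpha> lam :: real
    and Ip Im :: "nat set" and d :: int
  assumes "\<And>i. i \<in> {1..n} \<Longrightarrow> 0 < p i \<and> p i < 1"
    and "\<alpha> = Min ((\<lambda>i. min (p i) (1 - p i)) ` {1..n})"
    and "Ip \<subseteq> {1..n}" and "Im \<subseteq> {1..n}" and "Ip \<inter> Im = {}"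
    and "t = card (Ip \<union> Im)" and "t \<ge> 1"
    and "lam = (\<Prod>i\<in>Ip. p i) * (\<Prod>i\<in>Im. 1 - p i)"
    and "(1 - \<alpha>) powi d \<le> \<alpha>"
    and "real_of_int d \<le> (real n - real t) / real t"
  shows "(1 - real t * real_of_int d / (real n - real t)) ^ t
           * (1 - (1 - \<alpha>) powi d / \<alpha>) ^ (t - 1) * lam
         \<le> measure_pmf.expectation (dep_round n p)
              (\<lambda>X. (\<Prod>i\<in>Ip. X i) * (\<Prod>i\<in>Im. 1 - X i))"
proof -
  let ?J = "Ip \<union> Im"
  have J: "?J \<subseteq> {1..n}" "finite Ip" "finite Im"
    using assms(3,4) finite_subset by auto
  have n: "n \<ge> 1"
    using assms(6,7) J(1) by (cases n) auto
  have "\<alpha> \<in> (\<lambda>i. min (p i) (1 - p i)) ` {1..n}"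
    unfolding assms(2) using n by (intro Min_in) auto
  then obtain i0 where i0: "i0 \<in> {1..n}" "\<alpha> = min (p i0) (1 - p i0)"
    by blast
  then have \<alpha>: "0 < \<alpha>" "\<alpha> < 1"
    using assms(1)[OF i0(1)] by (auto simp: min_def)
  have p\<alpha>: "\<alpha> \<le> p i \<and> p i \<le> 1 - \<alpha>" if "i \<in> {1..n}" for i
  proof -
    have "\<alpha> \<le> min (p i) (1 - p i)"
      unfolding assms(2) using that by (intro Min_le) auto
    then show ?thesis by linarith
  qed
  interpret signed_indices Ip Im p \<alpha>
    using \<alpha> by unfold_locales
  \<comment> \<open>A nonpositive exponent would make the power at least 1 and thus larger than
    \<alpha>; so \<open>d\<close> can be replaced by a natural number.\<close>
  have "0 < d"
  proof (rule ccontr)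
    assume "\<not> 0 < d"
    then have "1 \<le> inverse (1 - \<alpha>) ^ nat (- d)"
      using \<alpha> by (intro one_le_power) (simp add: one_le_inverse)
    then have "1 \<le> (1 - \<alpha>) powi d"
      using \<open>\<not> 0 < d\<close> by (cases "d = 0") (auto simp: power_int_def)
    then show False using assms(9) \<alpha> by linarith
  qed
  then obtain D where D: "d = int D" "D \<ge> 1"
    by (metis nat_0_le less_imp_le zero_less_imp_eq_int less_eq_Suc_le One_nat_def)
  have "real D * real t \<le> real n - real t"
    using assms(7,10) D by (simp add: pos_le_divide_eq)
  then have "real (t * D + t) \<le> real n"
    by (simp add: mult.commute)
  then have tD: "t * D + t \<le> n"
    by (simp only: of_nat_le_iff)
  \<comment> \<open>This makes \<open>t < n\<close> strict and the denominator \<open>n - t\<close>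
    positive.\<close>
  moreover have "1 \<le> t * D" using assms(7) D(2) by simp
  ultimately have tn: "t < n" "t * D \<le> n - t" by linarith+
  let ?\<kappa> = "(1 - (1 - \<alpha>) ^ D / \<alpha>) ^ (t - 1)"
  have powD: "(1 - \<alpha>) ^ D \<le> \<alpha>" using assms(9) D by simp
  have prod_split: "(\<Prod>i\<in>{1..n}. literal i (X i)) = (\<Prod>i\<in>Ip. X i) * (\<Prod>i\<in>Im. 1 - X i)" for X
  proof -
    have "(\<Prod>i\<in>{1..n}. literal i (X i)) = (\<Prod>i\<in>Ip \<union> Im. literal i (X i))"
      using J by (intro prod.mono_neutral_right) (auto simp: literal_notin)
    also have "\<dots> = (\<Prod>i\<in>Ip. literal i (X i)) * (\<Prod>i\<in>Im. literal i (X i))"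
      using J assms(5) by (intro prod.union_disjoint) auto
    also have "\<dots> = (\<Prod>i\<in>Ip. X i) * (\<Prod>i\<in>Im. 1 - X i)"
      using assms(5) by (intro arg_cong2[of _ _ _ _ "(*)"] prod.cong) (auto simp: literal_def)
    finally show ?thesis .
  qed
  define f where "f = (\<lambda>X :: nat \<Rightarrow> real. (\<Prod>i\<in>Ip. X i) * (\<Prod>i\<in>Im. 1 - X i))"
  define E where "E \<pi> = measure_pmf.expectation (dep_round_loop \<pi> p) f" for \<pi>
  let ?P = "permutations_of_set {1..n}"
  \<comment> \<open>Initial debt 0 demands no gap before the first literal, which leaves
    \<open>t - 1\<close> gaps.\<close>
  let ?S = "{\<pi> \<in> ?P. separated ?J D 0 \<pi>}"
  have E_eq: "E \<pi> = measure_pmf.expectation (dep_round_loop \<pi> p) (\<lambda>X. \<Prod>i\<in>set \<pi>. literal i (X i))"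
    if "\<pi> \<in> ?P" for \<pi>
    unfolding E_def f_def permutations_of_setD(1)[OF that] prod_split ..
  have E0: "0 \<le> E \<pi>" and Eg: "guarantee \<pi> \<le> E \<pi>" if "\<pi> \<in> ?P" for \<pi>
    using expectation_dep_round_loop_ge_guarantee[of \<pi>] permutations_of_setD[OF that] p\<alpha>
    unfolding E_eq[OF that] by auto
  have Es: "?\<kappa> * lam \<le> E \<pi>" if "\<pi> \<in> ?S" for \<pi>
  proof -
    have \<pi>: "set \<pi> = {1..n}" "distinct \<pi>" "\<pi> \<in> ?P" "separated ?J D 0 \<pi>"
      using that permutations_of_setD by auto
    have "{1..n} \<inter> ?J = ?J" using J by auto
    then have "?\<kappa> * lam \<le> guarantee \<pi>"
      using guarantee_ge[of D 0 \<pi>] \<pi> powD assms(1,6,8) prod_split[of p] by (auto simp: less_imp_le)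
    then show ?thesis using Eg[OF \<pi>(3)] by linarith
  qed
  have lam: "0 \<le> lam"
    unfolding assms(8) using assms(1,3,4) by (intro mult_nonneg_nonneg prod_nonneg) (auto simp: less_imp_le subset_iff)
  have \<kappa>lam: "0 \<le> ?\<kappa> * lam"
    using lam powD \<alpha> by simp
  have "measure_pmf.expectation (dep_round n p) f = (\<Sum>\<pi>\<in>?P. E \<pi> / fact n)"
    unfolding dep_round_def E_def
    by (subst pmf_expectation_bind[where A = ?P])
      (auto simp: finite_set_pmf_dep_round_loop divide_inverse mult.commute)
  also have "\<dots> \<ge> (\<Sum>\<pi>\<in>?S. E \<pi> / fact n)"
    using E0 by (intro sum_mono2) auto
  also have "(\<Sum>\<pi>\<in>?S. E \<pi> / fact n) \<ge> (\<Sum>\<pi>\<in>?S. ?\<kappa> * lam / fact n)"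
    using Es by (intro sum_mono divide_right_mono) auto
  finally have lower: "real (card ?S) / fact n * (?\<kappa> * lam) \<le> measure_pmf.expectation (dep_round n p) f"
    by simp
  have cards: "card ({1..n} \<inter> ?J) = t" "card ({1..n} - ?J) = n - t"
    using J assms(6) by (simp_all add: Int_absorb1 card_Diff_subset)
  \<comment> \<open>Expanding \<open>fact n\<close> through \<open>n choose t\<close> produces the
    factorials of the count, so that only two binomial coefficients have to be compared.\<close>
  have "(1 - real t * real D / (real n - real t)) ^ t * fact n
      = (1 - real t * real D / (real n - real t)) ^ t * real (n choose t) * (fact t * fact (n - t))"
    using tn by (simp add: binomial_fact)
  also have "\<dots> \<le> real ((n - (t - 1) * D) choose t) * (fact t * fact (n - t))"
    using assms(7) tn by (intro mult_right_mono binomial_shift_ge) auto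
  also have "\<dots> = real (fact t * fact (n - t) * ((n - (t - 1) * D) choose t))"
    by simp
  also have "\<dots> \<le> real (card ?S)"
    using card_separated_permutations[of "{1..n}" ?J 0 D] unfolding cards of_nat_le_iff by simp
  finally have "(1 - real t * real D / (real n - real t)) ^ t \<le> real (card ?S) / fact n"
    by (simp add: pos_le_divide_eq)
  then have "(1 - real t * real D / (real n - real t)) ^ t * (?\<kappa> * lam) \<le> real (card ?S) / fact n * (?\<kappa> * lam)"
    using \<kappa>lam by (rule mult_right_mono)
  then show ?thesis
    using lower D by (simp add: f_def mult_ac)
qed

end
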